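(* There is an absolute constant $C$ such that the following holds. For a sufficiently large constant $c$, let $\frac{c}{n} \le p \le \frac{(\log n)^2}{n}$ and let $d = \lceil p(n-1) \rceil$. Then a random graph sampled from $G_{n,p,d}$ is $\delta$-asymmetric with probability tending to $1$ as $n \to \infty$, for $\delta = 1 - C/\sqrt{d}$.
   Context: The random graph model $G_{n,p,d}$ on vertex set $\{1,\dots,n\}$: first sample $G$ from $G_{n,p}$ (each of the $\binom n2$ possible edges present independently with probability $p$). Then for $i=1,2,\dots,n$ in order, let $d_i$ be the current degree of vertex $i$; if $d_i \ge d$ do nothing, and if $d_i < d$ add $d-d_i$ new ("auxiliary") edges incident to $i$, joining $i$ to vertices that are not currently neighbors of $i$, chosen uniformly at random. For two labeled graphs $G,H$ on the same $n$-vertex set, $dist(G,H)$ is half the Hamming distance between their adjacency matrices. For a permutation $\pi$ of the vertex set, $G_\pi$ is the graph obtained by applying $\pi$ to the vertices of $G$. A $k$-permutation is a permutation moving exactly $k$ elements and fixing the other $n-k$. For $\delta>0$, a graph $G$ with $n$ vertices and $m$ edges is $\delta$-asymmetric if for every $1 \le k \le n$ and every $k$-permutation $\pi$ of its vertices, $dist(G,G_\pi) \ge \delta \frac{k}{n} m$. *)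

theory Defs
  imports "HOL-Probability.Probability" "HOL-Probability.Product_PMF"
    "HOL-Combinatorics.Permutations" "HOL-Library.Ramsey"
begin

text \<open>A labeled graph on the vertex set \<open>{1..n}\<close> is represented by its edge set, a subset of
  \<open>nsets {1..n} 2\<close>, the set of two-element subsets of \<open>{1..n}\<close>.\<close>

type_synonym graph = "nat set set"

definition neighbours :: "graph \<Rightarrow> nat \<Rightarrow> nat set" where
  "neighbours E i = {j. {i, j} \<in> E}"

definition degree :: "graph \<Rightarrow> nat \<Rightarrow> nat" where
  "degree E i = card (neighbours E i)"

text \<open>\<open>bernoulli_pmf\<close> truncates its parameter to \<open>[0,1]\<close>, so \<open>gnp n p\<close> is the intended distribution
  only for \<open>p\<close> in that interval.\<close>

definition gnp :: "nat \<Rightarrow> real \<Rightarrow> graph pmf" where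
  "gnp n p = map_pmf (\<lambda>f. {e \<in> nsets {1..n} 2. f e})
     (Pi_pmf (nsets {1..n} 2) False (\<lambda>_. bernoulli_pmf p))"

text \<open>The auxiliary edges at \<open>i\<close> are given by a uniformly random set of \<open>d - degree E i\<close> current
  non-neighbours of \<open>i\<close>.  There are enough of them whenever \<open>d \<le> n - 1\<close>; otherwise \<open>pmf_of_set\<close> may be
  applied to the empty set, where its value is unspecified.\<close>

definition add_auxiliary :: "nat \<Rightarrow> nat \<Rightarrow> nat \<Rightarrow> graph \<Rightarrow> graph pmf" where
  "add_auxiliary n d i E =
     (if d \<le> degree E i then return_pmf E
      else map_pmf (\<lambda>S. E \<union> (\<lambda>j. {i, j}) ` S)
        (pmf_of_set (nsets ({1..n} - {i} - neighbours E i) (d - degree E i))))"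

definition gnpd :: "nat \<Rightarrow> real \<Rightarrow> nat \<Rightarrow> graph pmf" where
  "gnpd n p d = fold (\<lambda>i M. bind_pmf M (add_auxiliary n d i)) [1..<Suc n] (gnp n p)"

definition adjacency :: "graph \<Rightarrow> nat \<Rightarrow> nat \<Rightarrow> nat" where
  "adjacency E i j = of_bool ({i, j} \<in> E)"

definition graph_dist :: "nat \<Rightarrow> graph \<Rightarrow> graph \<Rightarrow> real" where
  "graph_dist n E F =
     real (card {(i, j) \<in> {1..n} \<times> {1..n}. adjacency E i j \<noteq> adjacency F i j}) / 2"

definition permute_graph :: "(nat \<Rightarrow> nat) \<Rightarrow> graph \<Rightarrow> graph" where
  "permute_graph \<pi> E = (\<lambda>e. \<pi> ` e) ` E"

definition k_permutation :: "nat \<Rightarrow> nat \<Rightarrow> (nat \<Rightarrow> nat) \<Rightarrow> bool" where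
  "k_permutation n k \<pi> \<longleftrightarrow> \<pi> permutes {1..n} \<and> card {i \<in> {1..n}. \<pi> i \<noteq> i} = k"

definition asymmetric_graph :: "nat \<Rightarrow> real \<Rightarrow> graph \<Rightarrow> bool" where
  "asymmetric_graph n \<delta> E \<longleftrightarrow> 0 < \<delta> \<and>
     (\<forall>k \<in> {1..n}. \<forall>\<pi>. k_permutation n k \<pi> \<longrightarrow>
        graph_dist n E (permute_graph \<pi> E) \<ge> \<delta> * (real k / real n) * real (card E))"

end

(* Half the Hamming distance of the adjacency matrices counts each edge of the symmetric
   difference once, which leaves enough room for every delta <= 1. A vertex i receives its auxiliary edges from a
   uniform choice, so a fixed set A of edges lies in the final graph with probability at most
   q^|A| for q = p + 2d/(n-d) = O(d/n). All degrees are at least d, so at least kd/2 edges meet the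
   k vertices moved by a permutation, and the distance is twice the number of edges not in the
   image graph. Hence delta-asymmetry follows if (1) the graph has at most (3/4)nd edges and
   (2) every k-permutation maps at most kd/16 edges to different edges of the graph.
   For (1), the final number of edges is at most |E| + sum_i max(0, d - deg_E(i)) for the initial
   graph E, which is a maximum of 2^n functions affine in the edge indicators; an exponential
   moment bound and a union bound apply. For (2), a third of the edges in question form a set F
   disjoint from its image, and F together with its image has 2|F| edges, all present. The union
   bound over F gives probability at most n^(-4k), against at most n^(2k) k-permutations. *)
theory Submission imports Defs "HOL-Real_Asymp.Real_Asymp" begin

section \<open>Edge containment\<close>

lemma prob_bind_pmf:
  "measure_pmf.prob (bind_pmf M N) X = measure_pmf.expectation M (\<lambda>x. measure_pmf.prob (N x) X)"
proof -
  have int: "integrable (measure_pmf M) (\<lambda>x. measure_pmf.prob (N x) X)"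
    by (rule measure_pmf.integrable_const_bound[where B=1]) auto
  have "ennreal (measure_pmf.prob (bind_pmf M N) X) =
      (\<integral>\<^sup>+x. ennreal (measure_pmf.prob (N x) X) \<partial>M)"
    by (simp flip: measure_pmf.emeasure_eq_measure)
  also have "\<dots> = ennreal (measure_pmf.expectation M (\<lambda>x. measure_pmf.prob (N x) X))"
    by (rule nn_integral_eq_integral[OF int]) auto
  finally show ?thesis by (simp add: integral_nonneg)
qed

text \<open>The process stopped after vertex \<open>t\<close>. The fold in \<open>gnpd\<close> has a
  fixed end, whereas the inductions below run over the number of treated vertices.\<close>

definition stage :: "nat \<Rightarrow> real \<Rightarrow> nat \<Rightarrow> nat \<Rightarrow> graph pmf" where
  "stage n p d t = fold (\<lambda>i M. bind_pmf M (add_auxiliary n d i)) [1..<Suc t] (gnp n p)"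

lemma stage_0: "stage n p d 0 = gnp n p"
  by (simp add: stage_def)

lemma stage_Suc: "stage n p d (Suc t) = bind_pmf (stage n p d t) (add_auxiliary n d (Suc t))"
  by (simp add: stage_def)

lemma gnpd_eq_stage: "gnpd n p d = stage n p d n"
  by (simp add: stage_def gnpd_def)

lemma set_pmf_gnp: "set_pmf (gnp n p) \<subseteq> Pow (nsets {1..n} 2)"
  by (auto simp: gnp_def)

text \<open>By independence this is an equality when \<open>A\<close> consists of possible edges;
  otherwise the event is null. Admitting every finite \<open>A\<close> spares the later induction
  over stages a side condition.\<close>

lemma prob_gnp_superset_le:
  assumes "finite A" "0 \<le> p" "p \<le> 1"
  shows "measure_pmf.prob (gnp n p) {E. A \<subseteq> E} \<le> p ^ card A"
proof (cases "A \<subseteq> nsets {1..n} 2")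
  case True
  have fin: "finite (nsets {1..n::nat} 2)"
    by (simp add: finite_imp_finite_nsets)
  have "measure_pmf.prob (gnp n p) {E. A \<subseteq> E} =
    measure_pmf.prob (Pi_pmf (nsets {1..n} 2) False (\<lambda>_. bernoulli_pmf p))
      (Pi (nsets {1..n} 2) (\<lambda>e. if e \<in> A then {True} else UNIV))"
    unfolding gnp_def measure_map_pmf
    by (rule arg_cong[where f="measure_pmf.prob _"]) (use True in \<open>auto simp: Pi_def\<close>)
  also have "\<dots> = (\<Prod>e\<in>nsets {1..n} 2. if e \<in> A then p else 1)"
    unfolding measure_Pi_pmf_Pi[OF fin]
    by (intro prod.cong) (use assms in \<open>auto simp: measure_pmf_single\<close>)
  also have "\<dots> = p ^ card A"
    using True fin by (simp add: prod.If_cases Int_absorb1)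
  finally show ?thesis by simp
next
  case False
  then have "measure_pmf.prob (gnp n p) {E. A \<subseteq> E} = 0"
    using set_pmf_gnp by (fastforce simp: measure_pmf_zero_iff)
  then show ?thesis using assms by simp
qed

text \<open>The quotient of the two binomials is the product of \<open>(s - j) / (m - j)\<close> for
  \<open>j < t\<close>, and each factor is at most \<open>s / m\<close>. The induction splits off
  one factor by the absorption identity.\<close>

lemma binomial_diff_le:
  assumes "t \<le> s" "s \<le> m"
  shows "real ((m - t) choose (s - t)) \<le> real (m choose s) * (real s / real m) ^ t"
  using assms
proof (induction t arbitrary: m s)
  case 0
  then show ?case by simp
next
  case (Suc t)
  have pos: "s > 0" "m > 0" using Suc.prems by auto
  have "real ((m - Suc t) choose (s - Suc t)) = real ((m - 1 - t) choose (s - 1 - t))"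
    by simp
  also have "\<dots> \<le> real ((m - 1) choose (s - 1)) * (real (s - 1) / real (m - 1)) ^ t"
    by (rule Suc.IH) (use Suc.prems in auto)
  also have "\<dots> \<le> real ((m - 1) choose (s - 1)) * (real s / real m) ^ t"
  proof (intro mult_left_mono power_mono)
    \<comment> \<open>For \<open>m = 1\<close> the left side is \<open>0 / 0\<close>, which is
      0.\<close>
    show "real (s - 1) / real (m - 1) \<le> real s / real m"
      using Suc.prems pos by (cases "m = 1") (auto simp: field_simps of_nat_diff)
  qed auto
  also have "real ((m - 1) choose (s - 1)) = real (m choose s) * (real s / real m)"
  proof -
    have "real s * real (m choose s) = real m * real ((m - 1) choose (s - 1))"
      using times_binomial_minus1_eq[OF pos(1), of m] by (metis of_nat_mult)
    then show ?thesis using pos by (simp add: field_simps)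
  qed
  finally show ?case by (simp add: mult_ac)
qed

lemma card_nsets: "finite A \<Longrightarrow> card (nsets A k) = card A choose k"
  by (metis (no_types, lifting) Collect_cong n_subsets nsets_def finite_subset)

text \<open>Deleting \<open>T\<close> injects the \<open>s\<close>-subsets containing
  \<open>T\<close> into the subsets of \<open>N - T\<close> of size \<open>s - card T\<close>. So
  sampling without replacement covers \<open>T\<close> no more likely than independent choices with
  probability \<open>s / card N\<close> would.\<close>

lemma prob_uniform_nsets_superset_le:
  assumes fin: "finite N" "finite T" and le: "s \<le> card N"
  shows "measure_pmf.prob (pmf_of_set (nsets N s)) {S. T \<subseteq> S} \<le> (real s / real (card N)) ^ card T"
proof -
  have ne: "nsets N s \<noteq> {}" using le fin by (auto simp: nsets_eq_empty_iff)
  have fn: "finite (nsets N s)" using fin by (simp add: finite_imp_finite_nsets)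
  have eq: "measure_pmf.prob (pmf_of_set (nsets N s)) {S. T \<subseteq> S} =
      real (card (nsets N s \<inter> {S. T \<subseteq> S})) / real (card N choose s)"
    using measure_pmf_of_set[OF ne fn] fin by (simp add: card_nsets)
  show ?thesis
  proof (cases "T \<subseteq> N \<and> card T \<le> s")
    case True
    have "card (nsets N s \<inter> {S. T \<subseteq> S}) \<le> card (nsets (N - T) (s - card T))"
    proof (rule card_inj_on_le)
      show "inj_on (\<lambda>S. S - T) (nsets N s \<inter> {S. T \<subseteq> S})"
        by (auto simp: inj_on_def)
      show "(\<lambda>S. S - T) ` (nsets N s \<inter> {S. T \<subseteq> S}) \<subseteq> nsets (N - T) (s - card T)"
        using fin by (auto simp: nsets_def card_Diff_subset)
      show "finite (nsets (N - T) (s - card T))"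
        using fin by (simp add: finite_imp_finite_nsets)
    qed
    also have "\<dots> = (card N - card T) choose (s - card T)"
      using True fin by (simp add: card_nsets card_Diff_subset)
    finally have "real (card (nsets N s \<inter> {S. T \<subseteq> S})) \<le> 
        real ((card N - card T) choose (s - card T))"
      by simp
    also have "\<dots> \<le> real (card N choose s) * (real s / real (card N)) ^ card T"
      using True le by (intro binomial_diff_le) auto
    finally show ?thesis unfolding eq using le by (simp add: field_simps)
  next
    case False
    then have "nsets N s \<inter> {S. T \<subseteq> S} = {}"
      using card_mono by (fastforce simp: nsets_def)
    then show ?thesis unfolding eq by simp
  qed
qed

section \<open>One auxiliary step\<close>

lemma finite_neighbours: "E \<subseteq> nsets {1..n} 2 \<Longrightarrow> finite (neighbours E i)"
  by (rule finite_subset[of _ "{1..n}"]) (auto simp: neighbours_def)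

lemma card_nonneighbours:
  assumes "E \<subseteq> nsets {1..n} 2" "i \<in> {1..n}"
  shows "card ({1..n} - {i} - neighbours E i) = n - 1 - degree E i"
proof -
  have "neighbours E i \<subseteq> {1..n} - {i}"
    using assms doubleton_in_nsets_2[of i _ "{1..n}"] unfolding neighbours_def by blast
  then show ?thesis
    using assms by (simp add: card_Diff_subset finite_neighbours degree_def)
qed

text \<open>For a given \<open>E\<close> only \<open>B = A - E\<close>, the set of edges that the
  step must supply, matters: if all of them contain \<open>i\<close> its term suffices, and
  otherwise the event is impossible. Summing over all candidates \<open>B\<close> gives a bound that
  can be integrated over \<open>E\<close>, each indicator turning into a containment probability one
  stage earlier.\<close>

lemma prob_add_auxiliary_superset_le:
  assumes E: "E \<subseteq> nsets {1..n} 2" and i: "i \<in> {1..n}" and d: "d < n" and A: "finite A"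
  shows "measure_pmf.prob (add_auxiliary n d i E) {E'. A \<subseteq> E'} \<le>
    (\<Sum>B\<in>Pow {e \<in> A. i \<in> e}. (real d / real (n - d)) ^ card B * indicator {E. A - B \<subseteq> E} E)"
    (is "_ \<le> ?R")
proof -
  let ?r = "real d / real (n - d)"
  have term_le: "?r ^ card B * indicator {E. A - B \<subseteq> E} E \<le> ?R" if "B \<subseteq> {e \<in> A. i \<in> e}" for B
    by (rule member_le_sum) (use that A in auto)
  show ?thesis
  proof (cases "d \<le> degree E i")
    case True
    have "measure_pmf.prob (add_auxiliary n d i E) {E'. A \<subseteq> E'} = indicator {E. A - {} \<subseteq> E} E"
      using True by (simp add: add_auxiliary_def)
    also have "\<dots> \<le> ?R" using term_le[of "{}"] by simp
    finally show ?thesis .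
  next
    case False
    define D where "D = A - E"
    define T where "T = {j. {i, j} \<in> D}"
    let ?s = "d - degree E i" and ?N = "{1..n} - {i} - neighbours E i"
    have inj: "inj (\<lambda>j. {i, j})" by (auto simp: inj_on_def doubleton_eq_iff)
    have cN: "card ?N = n - 1 - degree E i" by (rule card_nonneighbours[OF E i])
    have eq: "measure_pmf.prob (add_auxiliary n d i E) {E'. A \<subseteq> E'} =
        measure_pmf.prob (pmf_of_set (nsets ?N ?s)) {S. D \<subseteq> (\<lambda>j. {i, j}) ` S}"
      using False unfolding add_auxiliary_def D_def
      by (auto intro!: arg_cong[where f="measure_pmf.prob _"])
    show ?thesis
    proof (cases "D \<subseteq> range (\<lambda>j. {i, j})")
      case True
      then have DT: "D = (\<lambda>j. {i, j}) ` T" by (auto simp: T_def)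
      have finT: "finite T"
        using A finite_imageD[of "\<lambda>j. {i, j}" T] inj DT by (metis D_def finite_Diff inj_on_subset subset_UNIV)
      have cT: "card T = card D"
        unfolding DT using card_image[of "\<lambda>j. {i, j}" T] inj by (metis inj_on_subset subset_UNIV)
      have "{S. D \<subseteq> (\<lambda>j. {i, j}) ` S} = {S. T \<subseteq> S}"
        unfolding DT using inj by (simp add: inj_image_subset_iff)
      then have "measure_pmf.prob (add_auxiliary n d i E) {E'. A \<subseteq> E'} \<le>
          (real ?s / real (card ?N)) ^ card D"
        unfolding eq cT[symmetric] using finT
        by (simp, intro prob_uniform_nsets_superset_le) (use d False cN in auto)
      \<comment> \<open>Since \<open>degree E i < d\<close>, there are at least \<open>n - d\<close>
        non-neighbours, of which at most \<open>d\<close> are chosen.\<close>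
      also have "\<dots> \<le> ?r ^ card D"
      proof (intro power_mono frac_le)
        show "real (n - d) \<le> real (card ?N)" using False d unfolding cN by auto
      qed (use d in auto)
      also have "\<dots> = ?r ^ card D * indicator {E. A - D \<subseteq> E} E"
        by (simp add: D_def indicator_def Diff_Diff_Int)
      also have "\<dots> \<le> ?R"
        by (rule term_le) (use DT in \<open>auto simp: D_def\<close>)
      finally show ?thesis .
    next
      case False
      then have "{S. D \<subseteq> (\<lambda>j. {i, j}) ` S} = {}" by blast
      then have "measure_pmf.prob (add_auxiliary n d i E) {E'. A \<subseteq> E'} = 0"
        unfolding eq by simp
      also have "\<dots> \<le> ?R" by (intro sum_nonneg) auto
      finally show ?thesis .
    qed
  qed
qed

lemma set_pmf_add_auxiliary:
  assumes E: "E \<subseteq> nsets {1..n} 2" and i: "i \<in> {1..n}" and d: "d < n"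
    and E': "E' \<in> set_pmf (add_auxiliary n d i E)"
  shows "E \<subseteq> E'" "E' \<subseteq> nsets {1..n} 2" "d \<le> degree E' i"
    "card E' \<le> card E + (d - degree E i)"
proof -
  let ?s = "d - degree E i" and ?N = "{1..n} - {i} - neighbours E i"
  have finE: "finite E" using E finite_subset finite_imp_finite_nsets[of "{1..n}" 2] by blast
  have "E \<subseteq> E' \<and> E' \<subseteq> nsets {1..n} 2 \<and> d \<le> degree E' i \<and> card E' \<le> card E + (d - degree E i)"
  proof (cases "d \<le> degree E i")
    case True
    then show ?thesis using E E' by (simp add: add_auxiliary_def)
  next
    case False
    \<comment> \<open>\<open>d < n\<close> leaves at least \<open>d - degree E i\<close>
      non-neighbours, so \<open>pmf_of_set\<close> is applied to a nonempty family and its support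
      is known.\<close>
    have ne: "nsets ?N ?s \<noteq> {}"
      using card_nonneighbours[OF E i] d False by (auto simp: nsets_eq_empty_iff)
    have "set_pmf (pmf_of_set (nsets ?N ?s)) = nsets ?N ?s"
      by (rule set_pmf_of_set[OF ne]) (simp add: finite_imp_finite_nsets)
    then obtain S where S: "S \<in> nsets ?N ?s" "E' = E \<union> (\<lambda>j. {i, j}) ` S"
      using E' False by (auto simp: add_auxiliary_def)
    have sub: "E' \<subseteq> nsets {1..n} 2"
      proof -
      have "S \<subseteq> ?N" using S(1) by (auto simp: nsets_def)
      then have "{i, j} \<in> nsets {1..n} 2" if "j \<in> S" for j
        using that i unfolding doubleton_in_nsets_2 by auto
      then show ?thesis using S(2) E by auto
    qed
    have "card E' \<le> card E + card ((\<lambda>j. {i, j}) ` S)"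
      unfolding S(2) by (rule card_Un_le)
    also have "\<dots> \<le> card E + card S"
      using S by (intro add_left_mono card_image_le) (auto simp: nsets_def)
    also have "card S = ?s" using S by (auto simp: nsets_def)
    finally have c: "card E' \<le> card E + ?s" .
    have "d = degree E i + ?s" using False by simp
    also have "\<dots> = card (neighbours E i \<union> S)"
      using S finite_neighbours[OF E, of i]
      by (subst card_Un_disjoint) (auto simp: degree_def nsets_def)
    also have "\<dots> \<le> degree E' i"
      unfolding degree_def
      by (rule card_mono) (use finite_neighbours[OF sub] S(2) in \<open>auto simp: neighbours_def\<close>)
    finally show ?thesis using c sub S(2) by auto
  qed
  then show "E \<subseteq> E'" "E' \<subseteq> nsets {1..n} 2" "d \<le> degree E' i"
    "card E' \<le> card E + (d - degree E i)" by auto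
qed

section \<open>The process after \<open>t\<close> steps\<close>

lemma degree_mono: "E \<subseteq> E' \<Longrightarrow> E' \<subseteq> nsets {1..n} 2 \<Longrightarrow> degree E i \<le> degree E' i"
  unfolding degree_def by (rule card_mono[OF finite_neighbours]) (auto simp: neighbours_def)

text \<open>A vertex reaches degree \<open>d\<close> at its own step, and later steps only add
  edges.\<close>

lemma set_pmf_stage:
  assumes "d < n" "t \<le> n" "E \<in> set_pmf (stage n p d t)"
  shows "E \<subseteq> nsets {1..n} 2 \<and> (\<forall>i\<in>{1..t}. d \<le> degree E i)"
  using assms(2,3)
proof (induction t arbitrary: E)
  case 0
  then show ?case using set_pmf_gnp by (auto simp: stage_0)
next
  case (Suc t)
  then obtain F where F: "F \<in> set_pmf (stage n p d t)" "E \<in> set_pmf (add_auxiliary n d (Suc t) F)"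
    by (auto simp: stage_Suc)
  have IH: "F \<subseteq> nsets {1..n} 2" "\<forall>i\<in>{1..t}. d \<le> degree F i"
    using Suc.IH[OF _ F(1)] Suc.prems by auto
  note * = set_pmf_add_auxiliary[OF IH(1) _ assms(1) F(2)]
  have "d \<le> degree E i" if "i \<in> {1..Suc t}" for i
  proof (cases "i = Suc t")
    case True
    then show ?thesis using * Suc.prems by simp
  next
    case False
    then have "d \<le> degree F i" using IH that by auto
    also have "\<dots> \<le> degree E i" using * Suc.prems by (intro degree_mono[of _ _ n]) auto
    finally show ?thesis .
  qed
  then show ?case using * Suc.prems by auto
qed

text \<open>An edge \<open>{i, j}\<close> can be created in the initial graph and in the steps \<open>i\<close> and \<open>j\<close>.\<close>

lemma prob_stage_superset_le_prod:
  assumes p: "0 \<le> p" "p \<le> 1" and d: "d < n" and t: "t \<le> n" and A: "finite A"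
  shows "measure_pmf.prob (stage n p d t) {E. A \<subseteq> E} \<le>
    (\<Prod>e\<in>A. p + real d / real (n - d) * real (card (e \<inter> {1..t})))"
  using t A
proof (induction t arbitrary: A)
  case 0
  then show ?case using prob_gnp_superset_le[of A p n] p by (simp add: stage_0)
next
  case (Suc t)
  let ?r = "real d / real (n - d)" and ?M = "stage n p d t"
  define w where "w s e = p + ?r * real (card (e \<inter> {1..s}))" for s :: nat and e :: "nat set"
  have w: "w (Suc t) e = w t e + (if Suc t \<in> e then ?r else 0)" for e
  proof -
    have "e \<inter> {1..Suc t} = (if Suc t \<in> e then insert (Suc t) (e \<inter> {1..t}) else e \<inter> {1..t})"
      by (auto simp: atLeastAtMostSuc_conv)
    then show ?thesis by (simp add: w_def distrib_left add_divide_distrib)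
  qed
  have "measure_pmf.prob (stage n p d (Suc t)) {E. A \<subseteq> E} =
      measure_pmf.expectation ?M (\<lambda>E. measure_pmf.prob (add_auxiliary n d (Suc t) E) {E'. A \<subseteq> E'})"
    unfolding stage_Suc by (rule prob_bind_pmf)
  also have "\<dots> \<le> measure_pmf.expectation ?M (\<lambda>E. \<Sum>B\<in>Pow {e \<in> A. Suc t \<in> e}.
      ?r ^ card B * indicator {E. A - B \<subseteq> E} E)"
  proof (intro integral_mono_AE Bochner_Integration.integrable_sum)
    show "AE E in ?M. measure_pmf.prob (add_auxiliary n d (Suc t) E) {E'. A \<subseteq> E'} \<le>
      (\<Sum>B\<in>Pow {e \<in> A. Suc t \<in> e}. ?r ^ card B * indicator {E. A - B \<subseteq> E} E)"
      unfolding AE_measure_pmf_iff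
    proof
      fix E assume "E \<in> set_pmf ?M"
      then have "E \<subseteq> nsets {1..n} 2" using set_pmf_stage[OF d, of t] Suc.prems by (meson Suc_leD)
      then show "measure_pmf.prob (add_auxiliary n d (Suc t) E) {E'. A \<subseteq> E'} \<le>
          (\<Sum>B\<in>Pow {e \<in> A. Suc t \<in> e}. ?r ^ card B * indicator {E. A - B \<subseteq> E} E)"
        using Suc.prems d by (intro prob_add_auxiliary_superset_le) auto
    qed
    show "integrable ?M (\<lambda>E. measure_pmf.prob (add_auxiliary n d (Suc t) E) {E'. A \<subseteq> E'})"
      by (rule measure_pmf.integrable_const_bound[where B=1]) auto
  qed (auto simp: measure_pmf.emeasure_eq_measure)
  also have "\<dots> = (\<Sum>B\<in>Pow {e \<in> A. Suc t \<in> e}. ?r ^ card B * measure_pmf.prob ?M {E. A - B \<subseteq> E})"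
    by (subst Bochner_Integration.integral_sum) (auto simp: measure_pmf.emeasure_eq_measure)
  also have "\<dots> \<le> (\<Sum>B\<in>Pow {e \<in> A. Suc t \<in> e}. ?r ^ card B * (\<Prod>e\<in>A - B. w t e))"
    unfolding w_def using Suc by (intro sum_mono mult_left_mono) auto
  \<comment> \<open>With the factor 0 for edges avoiding \<open>Suc t\<close>, the sum can be
    extended to all of \<open>Pow A\<close>, where it is the expansion of a product of two-term
    sums.\<close>
  also have "\<dots> = (\<Sum>B\<in>Pow {e \<in> A. Suc t \<in> e}. 
      (\<Prod>e\<in>B. if Suc t \<in> e then ?r else 0) * (\<Prod>e\<in>A - B. w t e))"
  proof (intro sum.cong refl)
    fix B assume "B \<in> Pow {e \<in> A. Suc t \<in> e}"
    then have "(\<Prod>e\<in>B. if Suc t \<in> e then ?r else 0) = (\<Prod>e\<in>B. ?r)"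
      by (intro prod.cong) auto
    then show "?r ^ card B * (\<Prod>e\<in>A - B. w t e) =
      (\<Prod>e\<in>B. if Suc t \<in> e then ?r else 0) * (\<Prod>e\<in>A - B. w t e)"
      by simp
  qed
  also have "\<dots> \<le> (\<Sum>B\<in>Pow A. 
      (\<Prod>e\<in>B. if Suc t \<in> e then ?r else 0) * (\<Prod>e\<in>A - B. w t e))"
  proof (rule sum_mono2)
    fix B
    show "0 \<le> (\<Prod>e\<in>B. if Suc t \<in> e then ?r else 0) * (\<Prod>e\<in>A - B. w t e)"
      using p by (intro mult_nonneg_nonneg prod_nonneg) (auto simp: w_def)
  qed (use Suc.prems in auto)
  also have "\<dots> = (\<Prod>e\<in>A. (if Suc t \<in> e then ?r else 0) + w t e)"
    by (rule prod_add[symmetric]) (use Suc.prems in auto)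
  also have "\<dots> = (\<Prod>e\<in>A. w (Suc t) e)"
    by (intro prod.cong) (auto simp: w)
  finally show ?case by (simp add: w_def)
qed

text \<open>At the end both endpoints of every edge have been treated, whence the factor 2.\<close>

lemma prob_gnpd_superset_le:
  assumes p: "0 \<le> p" "p \<le> 1" and d: "d < n" and A: "A \<subseteq> nsets {1..n} 2"
  shows "measure_pmf.prob (gnpd n p d) {E. A \<subseteq> E} \<le> (p + 2 * (real d / real (n - d))) ^ card A"
proof -
  have finA: "finite A" using A finite_subset finite_imp_finite_nsets[of "{1..n}" 2] by blast
  have "measure_pmf.prob (gnpd n p d) {E. A \<subseteq> E} \<le>
    (\<Prod>e\<in>A. p + real d / real (n - d) * real (card (e \<inter> {1..n})))"
    unfolding gnpd_eq_stage by (rule prob_stage_superset_le_prod) (use assms finA in auto)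
  also have "\<dots> = (\<Prod>e\<in>A. p + 2 * (real d / real (n - d)))"
  proof (intro prod.cong refl)
    fix e assume "e \<in> A"
    then have "e \<inter> {1..n} = e" "card e = 2" using A by (auto simp: nsets_def)
    then show "p + real d / real (n - d) * real (card (e \<inter> {1..n})) = p + 2 * (real d / real (n - d))"
      by simp
  qed
  finally show ?thesis by simp
qed

section \<open>The number of edges\<close>

lemma degree_eq_card_incident:
  assumes "E \<subseteq> nsets {1..n} 2"
  shows "degree E i = card {e \<in> E. i \<in> e}"
proof -
  have "{e \<in> E. i \<in> e} = (\<lambda>j. {i, j}) ` neighbours E i"
  proof (intro equalityI subsetI)
    fix e assume e: "e \<in> {e \<in> E. i \<in> e}"
    then obtain x y where "e = {x, y}" using assms by (auto simp: nsets_def card_2_iff)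
    then obtain j where "e = {i, j}" using e by (metis (lifting) insert_commute insertE mem_Collect_eq singletonD)
    then show "e \<in> (\<lambda>j. {i, j}) ` neighbours E i" using e by (auto simp: neighbours_def)
  qed (auto simp: neighbours_def)
  moreover have "inj_on (\<lambda>j. {i, j}) (neighbours E i)"
    by (auto simp: inj_on_def doubleton_eq_iff)
  ultimately show ?thesis by (simp add: degree_def card_image)
qed

text \<open>Double counting of incidences. Later \<open>S\<close> is the whole vertex set, a set of
  low-degree vertices, or the set of vertices moved by a permutation.\<close>

lemma sum_degree_eq:
  assumes E: "E \<subseteq> nsets {1..n} 2" and S: "finite S"
  shows "(\<Sum>i\<in>S. degree E i) = (\<Sum>e\<in>E. card (e \<inter> S))"
proof -
  have finE: "finite E" using E finite_subset finite_imp_finite_nsets[of "{1..n}" 2] by blast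
  have "(\<Sum>i\<in>S. degree E i) = (\<Sum>i\<in>S. \<Sum>e\<in>E. if i \<in> e then 1 else 0)"
    using finE by (intro sum.cong) (auto simp: degree_eq_card_incident[OF E] sum.If_cases Int_def)
  also have "\<dots> = (\<Sum>e\<in>E. \<Sum>i\<in>S. if i \<in> e then 1 else 0)"
    by (rule sum.swap)
  also have "\<dots> = (\<Sum>e\<in>E. card (e \<inter> S))"
    using S by (intro sum.cong) (auto simp: sum.If_cases Int_commute)
  finally show ?thesis .
qed

lemma degree_nsets: "i \<in> {1..n} \<Longrightarrow> degree (nsets {1..n} 2) i = n - 1"
proof -
  assume i: "i \<in> {1..n}"
  have "neighbours (nsets {1..n} 2) i = {1..n} - {i}"
    using i unfolding neighbours_def doubleton_in_nsets_2 by auto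
  then show ?thesis using i by (simp add: degree_def)
qed

text \<open>A deficit can only shrink before its vertex is treated, so this quantity never increases
  along the process. At \<open>t = n\<close> it is the final number of edges, and at
  \<open>t = 0\<close> it depends on the initial random graph alone.\<close>

definition potential :: "nat \<Rightarrow> nat \<Rightarrow> nat \<Rightarrow> graph \<Rightarrow> nat" where
  "potential n d t E = card E + (\<Sum>i\<in>{t<..n}. d - degree E i)"

text \<open>The step adds at most as many edges as the deficit of \<open>Suc t\<close>, which drops
  out of the sum; the remaining deficits do not grow.\<close>

lemma potential_add_auxiliary_le:
  assumes E: "E \<subseteq> nsets {1..n} 2" and t: "Suc t \<le> n" and d: "d < n"
    and E': "E' \<in> set_pmf (add_auxiliary n d (Suc t) E)"
  shows "potential n d (Suc t) E' \<le> potential n d t E"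
proof -
  note * = set_pmf_add_auxiliary[OF E _ d E']
  have "(\<Sum>i\<in>{Suc t<..n}. d - degree E' i) \<le> (\<Sum>i\<in>{Suc t<..n}. d - degree E i)"
    using * t by (intro sum_mono diff_le_mono2 degree_mono[of _ _ n]) auto
  moreover have "{t<..n} = insert (Suc t) {Suc t<..n}" using t by auto
  ultimately show ?thesis using * t by (simp add: potential_def)
qed

text \<open>Monotonicity on the support carries the tail event back, step by step, to the graph with
  independent edges.\<close>

lemma prob_potential_stage_le:
  assumes d: "d < n" and t: "t \<le> n"
  shows "measure_pmf.prob (stage n p d t) {E. x < real (potential n d t E)} \<le>
    measure_pmf.prob (gnp n p) {E. x < real (potential n d 0 E)}"
  using t
proof (induction t)
  case 0
  then show ?case by (simp add: stage_0)
next
  case (Suc t)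
  let ?M = "stage n p d t"
  have "measure_pmf.prob (stage n p d (Suc t)) {E. x < real (potential n d (Suc t) E)} =
    measure_pmf.expectation ?M (\<lambda>E. measure_pmf.prob (add_auxiliary n d (Suc t) E)
      {E. x < real (potential n d (Suc t) E)})"
    unfolding stage_Suc by (rule prob_bind_pmf)
  also have "\<dots> \<le> measure_pmf.expectation ?M (indicator {E. x < real (potential n d t E)})"
  proof (rule integral_mono_AE)
    show "integrable ?M (\<lambda>E. measure_pmf.prob (add_auxiliary n d (Suc t) E)
      {E. x < real (potential n d (Suc t) E)})"
      by (rule measure_pmf.integrable_const_bound[where B=1]) auto
    have "measure_pmf.prob (add_auxiliary n d (Suc t) E) {E. x < real (potential n d (Suc t) E)}
       \<le> indicator {E. x < real (potential n d t E)} E" if "E \<in> set_pmf ?M" for E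
    proof (cases "x < real (potential n d t E)")
      case False
      have "E \<subseteq> nsets {1..n} 2" using set_pmf_stage[OF d _ that] Suc.prems by simp
      then have "measure_pmf.prob (add_auxiliary n d (Suc t) E)
          {E. x < real (potential n d (Suc t) E)} = 0"
        using potential_add_auxiliary_le[of E n t d] Suc.prems d False
        by (fastforce simp: measure_pmf_zero_iff)
      then show ?thesis by simp
    qed simp
    then show "AE E in ?M. measure_pmf.prob (add_auxiliary n d (Suc t) E)
        {E. x < real (potential n d (Suc t) E)} \<le> indicator {E. x < real (potential n d t E)} E"
      by (simp add: AE_measure_pmf_iff)
  qed (auto simp: measure_pmf.emeasure_eq_measure)
  also have "\<dots> = measure_pmf.prob ?M {E. x < real (potential n d t E)}"
    by simp
  also have "\<dots> \<le> measure_pmf.prob (gnp n p) {E. x < real (potential n d 0 E)}"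
    using Suc by simp
  finally show ?case .
qed

text \<open>Independence factors the expectation, and each factor
  \<open>1 + p * (exp (w e) - 1)\<close> is controlled by \<open>exp x <= 1 + x + x^2\<close> for
  \<open>|x| <= 1\<close> and then by \<open>1 + y <= exp y\<close>.\<close>

lemma expectation_gnp_exp_weight_le:
  assumes p: "0 \<le> p" "p \<le> 1" and w: "\<And>e. \<bar>w e\<bar> \<le> 1"
  shows "measure_pmf.expectation (gnp n p) (\<lambda>E. exp (\<Sum>e\<in>E. w e)) \<le>
    exp (p * (\<Sum>e\<in>nsets {1..n} 2. w e + (w e)\<^sup>2))"
proof -
  let ?U = "nsets {1..n} 2"
  have fin: "finite ?U" by (simp add: finite_imp_finite_nsets)
  have "measure_pmf.expectation (gnp n p) (\<lambda>E. exp (\<Sum>e\<in>E. w e)) =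
    measure_pmf.expectation (Pi_pmf ?U False (\<lambda>_. bernoulli_pmf p))
      (\<lambda>f. \<Prod>e\<in>?U. if f e then exp (w e) else 1)"
    unfolding gnp_def integral_map_pmf
  proof (rule Bochner_Integration.integral_cong)
    fix f :: "nat set \<Rightarrow> bool"
    have "(\<Sum>e\<in>{e \<in> ?U. f e}. w e) = (\<Sum>e\<in>?U. if f e then w e else 0)"
      using fin by (simp add: sum.If_cases Int_def)
    then have "exp (\<Sum>e\<in>{e \<in> ?U. f e}. w e) = (\<Prod>e\<in>?U. exp (if f e then w e else 0))"
      using fin by (simp add: exp_sum)
    also have "\<dots> = (\<Prod>e\<in>?U. if f e then exp (w e) else 1)"
      by (intro prod.cong) auto
    finally show "exp (\<Sum>e\<in>{e \<in> ?U. f e}. w e) = (\<Prod>e\<in>?U. if f e then exp (w e) else 1)" .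
  qed simp
  also have "\<dots> = (\<Prod>e\<in>?U. measure_pmf.expectation (bernoulli_pmf p) (\<lambda>b. if b then exp (w e) else 1))"
    by (rule expectation_prod_Pi_pmf[OF fin]) (auto intro: integrable_measure_pmf_finite)
  also have "\<dots> \<le> (\<Prod>e\<in>?U. exp (p * (w e + (w e)\<^sup>2)))"
  proof (intro prod_mono conjI)
    fix e assume "e \<in> ?U"
    have eq: "measure_pmf.expectation (bernoulli_pmf p) (\<lambda>b. if b then exp (w e) else 1) =
        1 + p * (exp (w e) - 1)"
      using p by (simp add: algebra_simps)
    show "0 \<le> measure_pmf.expectation (bernoulli_pmf p) (\<lambda>b. if b then exp (w e) else 1)"
      by (rule integral_nonneg_AE) auto
    have "exp (w e) \<le> 1 + w e + (w e)\<^sup>2"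
    proof (cases "w e \<ge> 0")
      case True then show ?thesis using exp_bound[of "w e"] w[of e] by simp
    next
      case False
      \<comment> \<open>For negative \<open>x\<close> one has \<open>1 - x <= exp (- x)\<close>, so
        \<open>exp x * (1 - x) <= 1 <= 1 - x^3 = (1 + x + x^2) * (1 - x)\<close>, and the positive
        factor \<open>1 - x\<close> cancels.\<close>
      have "exp (w e) * (1 - w e) \<le> exp (w e) * exp (- w e)"
        using exp_ge_add_one_self[of "- w e"] by (intro mult_left_mono) auto
      also have "\<dots> \<le> 1 - (w e) ^ 3"
        using False by (simp add: exp_minus zero_le_odd_power power_le_zero_eq)
      also have "\<dots> = (1 + w e + (w e)\<^sup>2) * (1 - w e)"
        by (simp add: algebra_simps power2_eq_square power3_eq_cube)
      finally show ?thesis using False by simp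
    qed
    then have "1 + p * (exp (w e) - 1) \<le> 1 + p * (w e + (w e)\<^sup>2)"
      using p by (intro add_left_mono mult_left_mono) auto
    also have "\<dots> \<le> exp (p * (w e + (w e)\<^sup>2))" by simp
    finally show "measure_pmf.expectation (bernoulli_pmf p) (\<lambda>b. if b then exp (w e) else 1) \<le>
        exp (p * (w e + (w e)\<^sup>2))" unfolding eq .
  qed
  also have "\<dots> = exp (p * (\<Sum>e\<in>?U. w e + (w e)\<^sup>2))"
    using fin by (simp add: exp_sum sum_distrib_left)
  finally show ?thesis .
qed

text \<open>Exponential Markov inequality.\<close>

lemma prob_gnp_weight_ge_le:
  assumes p: "0 \<le> p" "p \<le> 1" and w: "\<And>e. \<bar>w e\<bar> \<le> 1"
  shows "measure_pmf.prob (gnp n p) {E. a \<le> (\<Sum>e\<in>E. w e)} \<le>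
    exp (p * (\<Sum>e\<in>nsets {1..n} 2. w e + (w e)\<^sup>2) - a)"
proof -
  have fin: "finite (set_pmf (gnp n p))"
    using set_pmf_gnp finite_subset by (metis finite_Pow_iff finite_atLeastAtMost finite_imp_finite_nsets)
  have "measure_pmf.prob (gnp n p) {E. a \<le> (\<Sum>e\<in>E. w e)} =
      measure_pmf.expectation (gnp n p) (indicator {E. a \<le> (\<Sum>e\<in>E. w e)})"
    by simp
  also have "\<dots> \<le> measure_pmf.expectation (gnp n p) (\<lambda>E. exp (\<Sum>e\<in>E. w e) * exp (- a))"
    by (rule integral_mono_AE)
      (auto intro!: integrable_measure_pmf_finite fin simp: indicator_def simp flip: exp_add)
  also have "\<dots> = measure_pmf.expectation (gnp n p) (\<lambda>E. exp (\<Sum>e\<in>E. w e)) * exp (- a)"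
    by simp
  also have "\<dots> \<le> exp (p * (\<Sum>e\<in>nsets {1..n} 2. w e + (w e)\<^sup>2)) * exp (- a)"
    by (intro mult_right_mono expectation_gnp_exp_weight_le) (use assms in auto)
  finally show ?thesis by (simp flip: exp_add)
qed

text \<open>\<open>potential n d 0 E\<close> is the maximum over \<open>S\<close> of \<open>card E + (\<Sum>i\<in>S. d - degree E i)\<close>, attained at the
  set of vertices of degree below \<open>d\<close>; for fixed \<open>S\<close> this is affine in the edge indicators.\<close>

lemma prob_potential_gnp_le:
  assumes p: "0 \<le> p" "p \<le> 1" and n: "n > 0" and d: "real d - 1 \<le> p * (real n - 1)" "p * (real n - 1) \<le> real d"
  shows "measure_pmf.prob (gnp n p) {E. 3 / 4 * real n * real d < real (potential n d 0 E)} \<le>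
    exp (real n * (5 / 4 - real d / 32))"
proof -
  let ?U = "nsets {1..n} 2"
  have fin: "finite ?U" by (simp add: finite_imp_finite_nsets)
  \<comment> \<open>For an edge, \<open>1 - card (e \<inter> S)\<close> is 1, 0 or -1: its
    contribution to the edge count minus the degree sum over \<open>S\<close>. The scale 1/4 keeps
    the quadratic term at most 1/16.\<close>
  define w where "w S e = (1 - real (card (e \<inter> S))) / 4" for S e :: "nat set"
  define Ev where "Ev S = {E. (3 / 4 * real n * real d - real d * real (card S)) / 4 \<le> (\<Sum>e\<in>E. w S e)}" for S
  \<comment> \<open>The moment bound asks for bounded weights on all sets, while \<open>w S\<close>
    is bounded only on edges.\<close>
  define w' where "w' S e = (if e \<in> ?U then w S e else 0)" for S e
  have sum_w: "(\<Sum>e\<in>E. w S e) = (real (card E) - (\<Sum>i\<in>S. real (degree E i))) / 4"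
    if "E \<subseteq> ?U" "finite S" for E S
  proof -
    have "(\<Sum>i\<in>S. real (degree E i)) = (\<Sum>e\<in>E. real (card (e \<inter> S)))"
      using arg_cong[OF sum_degree_eq[OF that], of real] by simp
    then show ?thesis
      by (simp add: w_def sum_subtractf flip: sum_divide_distrib)
  qed
  have sum_w': "(\<Sum>e\<in>E. w' S e) = (\<Sum>e\<in>E. w S e)" if "E \<subseteq> ?U" for E S
    using that by (intro sum.cong) (auto simp: w'_def)
  have w'_bound: "\<bar>w' S e\<bar> \<le> 1 / 4" for S e
  proof (cases "e \<in> ?U")
    case True
    then have "card (e \<inter> S) \<le> 2"
      using card_mono[of e "e \<inter> S"] by (auto simp: nsets_def)
    then show ?thesis by (auto simp: w'_def w_def)
  qed (simp add: w'_def)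
  have cU: "real (card ?U) = real n * (real n - 1) / 2"
  proof -
    have "real (n choose 2) = real n * (real n - 1) / 2"
      using n by (simp add: choose_two real_of_nat_div of_nat_diff)
    then show ?thesis by (simp add: card_nsets)
  qed
  have one: "measure_pmf.prob (gnp n p) (Ev S) \<le> exp (real n / 4 - real n * real d / 32)"
    if S: "S \<in> Pow {1..n}" for S
  proof -
    have finS: "finite S" using S finite_subset by auto
    have cS: "real (card S) \<le> real n" using card_mono[of "{1..n}" S] S by simp
    let ?a = "(3 / 4 * real n * real d - real d * real (card S)) / 4"
    have "measure_pmf.prob (gnp n p) (Ev S) \<le> measure_pmf.prob (gnp n p) {E. ?a \<le> (\<Sum>e\<in>E. w' S e)}"
      by (rule measure_pmf.finite_measure_mono_AE)
        (use set_pmf_gnp[of n p] in \<open>auto simp: AE_measure_pmf_iff Ev_def sum_w' subset_iff\<close>)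
    also have "\<dots> \<le> exp (p * (\<Sum>e\<in>?U. w' S e + (w' S e)\<^sup>2) - ?a)"
      by (rule prob_gnp_weight_ge_le) (use p in \<open>auto intro: order_trans[OF w'_bound]\<close>)
    also have "\<dots> \<le> exp (real n / 4 - real n * real d / 32)"
    proof -
      have "(\<Sum>e\<in>?U. w' S e + (w' S e)\<^sup>2) \<le> (\<Sum>e\<in>?U. w' S e + 1 / 16)"
      proof (intro sum_mono add_left_mono)
        fix e
        have "(w' S e)\<^sup>2 \<le> (1 / 4)\<^sup>2" using w'_bound[of S e] by (simp only: abs_le_square_iff[symmetric])
        then show "(w' S e)\<^sup>2 \<le> 1 / 16" by (simp add: power2_eq_square)
      qed
      also have "\<dots> = (real (card ?U) - real (card S) * (real n - 1)) / 4 + real (card ?U) / 16"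
      proof -
        have "(\<Sum>i\<in>S. real (degree ?U i)) = (\<Sum>i\<in>S. real n - 1)"
          using S n degree_nsets[of _ n] by (intro sum.cong refl) (auto simp: subset_iff of_nat_diff)
        then show ?thesis
          using sum_w[of ?U S] sum_w'[of ?U S] finS by (simp add: sum.distrib)
      qed
      finally have "p * (\<Sum>e\<in>?U. w' S e + (w' S e)\<^sup>2) \<le>
          p * ((real (card ?U) - real (card S) * (real n - 1)) / 4 + real (card ?U) / 16)"
        using p by (intro mult_left_mono)
      also have "\<dots> = real n * (p * (real n - 1)) / 8 - real (card S) * (p * (real n - 1)) / 4 
          + real n * (p * (real n - 1)) / 32"
        unfolding cU by (simp add: field_simps)
      also have "\<dots> \<le> real n * real d / 8 - real (card S) * (real d - 1) / 4 + real n * real d / 32"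
        using d by (intro add_mono diff_mono divide_right_mono mult_left_mono) auto
      \<comment> \<open>The terms with \<open>d * card S\<close> cancel, leaving
        \<open>card S / 4\<close>, and \<open>1/8 + 1/32 - 3/16 = -1/32\<close>.\<close>
      also have "\<dots> - ?a \<le> real n / 4 - real n * real d / 32"
        using cS by (simp add: field_simps)
      finally show ?thesis by simp
    qed
    finally show ?thesis .
  qed
  have "measure_pmf.prob (gnp n p) {E. 3 / 4 * real n * real d < real (potential n d 0 E)} \<le>
    measure_pmf.prob (gnp n p) (\<Union>S\<in>Pow {1..n}. Ev S)"
  proof (rule measure_pmf.finite_measure_mono_AE)
    have "E \<in> (\<Union>S\<in>Pow {1..n}. Ev S)"
      if E: "E \<subseteq> ?U" and big: "3 / 4 * real n * real d < real (potential n d 0 E)" for E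
    proof -
      define S where "S = {i \<in> {1..n}. degree E i \<le> d}"
      have "(\<Sum>i\<in>{0<..n}. d - degree E i) = (\<Sum>i\<in>S. d - degree E i)"
        by (rule sum.mono_neutral_right) (auto simp: S_def)
      then have "real (potential n d 0 E) = real (card E) + (\<Sum>i\<in>S. real d - real (degree E i))"
        by (simp add: potential_def S_def of_nat_diff)
      also have "\<dots> = real (card E) + real d * real (card S) - (\<Sum>i\<in>S. real (degree E i))"
        by (simp add: sum_subtractf)
      finally have "E \<in> Ev S"
        using big sum_w[OF E, of S] by (simp add: Ev_def S_def field_simps)
      moreover have "S \<in> Pow {1..n}" by (auto simp: S_def)
      ultimately show ?thesis by blast
    qed
    then show "AE E in gnp n p. E \<in> {E. 3 / 4 * real n * real d < real (potential n d 0 E)} \<longrightarrow>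
      E \<in> (\<Union>S\<in>Pow {1..n}. Ev S)"
      using set_pmf_gnp[of n p] unfolding AE_measure_pmf_iff by blast
  qed simp
  also have "\<dots> \<le> (\<Sum>S\<in>Pow {1..n}. measure_pmf.prob (gnp n p) (Ev S))"
    by (rule measure_pmf.finite_measure_subadditive_finite) auto
  also have "\<dots> \<le> (\<Sum>S\<in>Pow {1..n}. exp (real n / 4 - real n * real d / 32))"
    by (intro sum_mono one)
  also have "\<dots> = 2 ^ n * exp (real n / 4 - real n * real d / 32)"
    by (simp add: card_Pow)
  \<comment> \<open>The \<open>2 ^ n\<close> choices of \<open>S\<close> cost at most
    \<open>exp n\<close>, which raises the \<open>n / 4\<close> in the exponent to
    \<open>5 / 4 * n\<close>.\<close>
  also have "\<dots> \<le> exp 1 ^ n * exp (real n / 4 - real n * real d / 32)"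
    using exp_ge_add_one_self[of 1] by (intro mult_right_mono power_mono) auto
  also have "\<dots> = exp (real n * (5 / 4 - real d / 32))"
    by (simp add: algebra_simps flip: exp_of_nat_mult exp_add)
  finally show ?thesis .
qed

lemma prob_gnpd_card_gt_le:
  assumes p: "0 \<le> p" "p \<le> 1" and n: "d < n"
    and d: "real d - 1 \<le> p * (real n - 1)" "p * (real n - 1) \<le> real d"
  shows "measure_pmf.prob (gnpd n p d) {E. 3 / 4 * real n * real d < real (card E)} \<le>
    exp (real n * (5 / 4 - real d / 32))"
proof -
  have "measure_pmf.prob (gnpd n p d) {E. 3 / 4 * real n * real d < real (card E)} \<le>
    measure_pmf.prob (gnp n p) {E. 3 / 4 * real n * real d < real (potential n d 0 E)}"
    using prob_potential_stage_le[OF n order_refl, of p "3 / 4 * real n * real d"]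
    by (simp add: gnpd_eq_stage potential_def)
  also have "\<dots> \<le> exp (real n * (5 / 4 - real d / 32))"
    by (rule prob_potential_gnp_le) (use assms in auto)
  finally show ?thesis .
qed

section \<open>Edges preserved by a permutation\<close>

lemma image_permutes_nsets:
  assumes "\<pi> permutes A" "e \<in> nsets A k"
  shows "\<pi> ` e \<in> nsets A k"
  using assms permutes_inj[OF assms(1)]
  by (auto simp: nsets_def permutes_in_image card_image inj_on_subset)

lemma inj_image_permutes: "\<pi> permutes A \<Longrightarrow> inj ((`) \<pi>)"
  by (metis bij_betw_def bij_betw_imp_inj_on inj_image_eq_iff inj_onI permutes_inj)

text \<open>Edges fixed as sets are left out: few of them meet a moved vertex, and without them the
  image map has no fixed point, as \<open>exists_third_disjoint_image\<close> requires.\<close>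

definition kept_edges :: "(nat \<Rightarrow> nat) \<Rightarrow> graph \<Rightarrow> graph" where
  "kept_edges \<pi> E = {e \<in> E. \<pi> ` e \<in> E \<and> \<pi> ` e \<noteq> e}"

lemma sum_card_Int_le:
  assumes "E \<subseteq> nsets {1..n} 2" "finite E"
  shows "(\<Sum>e\<in>E. card (e \<inter> M)) \<le> 2 * card {e \<in> E. e \<inter> M \<noteq> {}}"
proof -
  have "(\<Sum>e\<in>E. card (e \<inter> M)) = (\<Sum>e\<in>{e \<in> E. e \<inter> M \<noteq> {}}. card (e \<inter> M))"
    using assms by (intro sum.mono_neutral_right) auto
  also have "\<dots> \<le> (\<Sum>e\<in>{e \<in> E. e \<inter> M \<noteq> {}}. 2)"
  proof (rule sum_mono)
    fix e assume "e \<in> {e \<in> E. e \<inter> M \<noteq> {}}"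
    then have "finite e" "card e = 2" using assms by (auto simp: nsets_def)
    then show "card (e \<inter> M) \<le> 2" using card_mono[of e "e \<inter> M"] by simp
  qed
  finally show ?thesis by simp
qed

text \<open>The differing ordered pairs are counted by the degree sum of the symmetric difference,
  in which each edge counts twice; halving undoes this.\<close>

lemma graph_dist_eq:
  assumes "E \<subseteq> nsets {1..n} 2" "F \<subseteq> nsets {1..n} 2"
  shows "graph_dist n E F = real (card ((E - F) \<union> (F - E)))"
proof -
  let ?D = "(E - F) \<union> (F - E)"
  have D: "?D \<subseteq> nsets {1..n} 2" using assms by auto
  have "{(i, j) \<in> {1..n} \<times> {1..n}. adjacency E i j \<noteq> adjacency F i j} = Sigma {1..n} (neighbours ?D)"
    using D by (auto simp: adjacency_def neighbours_def)
  then have "card {(i, j) \<in> {1..n} \<times> {1..n}. adjacency E i j \<noteq> adjacency F i j} =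
      (\<Sum>i\<in>{1..n}. degree ?D i)"
    using finite_neighbours[OF D] by (simp add: card_SigmaI degree_def)
  also have "\<dots> = (\<Sum>e\<in>?D. card (e \<inter> {1..n}))"
    by (rule sum_degree_eq[OF D]) simp
  also have "\<dots> = (\<Sum>e\<in>?D. 2)"
    using D by (intro sum.cong refl) (auto simp: nsets_def Int_absorb2)
  finally show ?thesis by (simp add: graph_dist_def)
qed

text \<open>At least \<open>k * d / 2\<close> edges meet the moved vertices. Each of them is missing
  from the image graph, or is the image of a kept edge, or is fixed as a set and then equals
  \<open>{i, \<pi> i}\<close> for a moved \<open>i\<close>, which gives at most \<open>k\<close>
  edges. Both graphs have equally many edges, so the distance is twice the number of missing
  ones.\<close>

lemma graph_dist_permute_ge:
  assumes E: "E \<subseteq> nsets {1..n} 2" and deg: "\<And>i. i \<in> {1..n} \<Longrightarrow> d \<le> degree E i"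
    and pi: "k_permutation n k \<pi>"
  shows "real k * real d - 2 * real k - 2 * real (card (kept_edges \<pi> E)) \<le>
    graph_dist n E (permute_graph \<pi> E)"
proof -
  let ?F = "permute_graph \<pi> E" and ?f = "(`) \<pi>"
  define M where "M = {i \<in> {1..n}. \<pi> i \<noteq> i}"
  have perm: "\<pi> permutes {1..n}" and cM: "card M = k" and finM: "finite M"
    using pi by (auto simp: k_permutation_def M_def)
  have finE: "finite E" using E finite_subset finite_imp_finite_nsets[of "{1..n}" 2] by blast
  have inj: "inj ?f" by (rule inj_image_permutes[OF perm])
  have F: "?F \<subseteq> nsets {1..n} 2"
    using E image_permutes_nsets[OF perm] by (auto simp: permute_graph_def)
  have finF: "finite ?F" using finE by (simp add: permute_graph_def)
  have cF: "card ?F = card E"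
    unfolding permute_graph_def by (rule card_image) (rule inj_on_subset[OF inj], simp)
  have "card (E - ?F) = card (?F - E)"
    using cF finE finF card_Diff_subset_Int[of E ?F] card_Diff_subset_Int[of ?F E]
    by (simp add: Int_commute)
  then have dist: "graph_dist n E ?F = 2 * real (card (E - ?F))"
    unfolding graph_dist_eq[OF E F] using finE finF by (subst card_Un_disjoint) auto
  let ?T = "{e \<in> E. e \<inter> M \<noteq> {}}"
  have "?T \<subseteq> (E - ?F) \<union> ?f ` kept_edges \<pi> E \<union> (\<lambda>i. {i, \<pi> i}) ` M"
  proof
    fix e assume e: "e \<in> ?T"
    show "e \<in> (E - ?F) \<union> ?f ` kept_edges \<pi> E \<union> (\<lambda>i. {i, \<pi> i}) ` M"
    proof (cases "e \<in> ?F")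
      case True
      then obtain e' where e': "e' \<in> E" "e = \<pi> ` e'" by (auto simp: permute_graph_def)
      show ?thesis
      proof (cases "e = e'")
        case True
        obtain i where i: "i \<in> e" "i \<in> M" using e by auto
        have "\<pi> i \<in> e" using e' True i by auto
        moreover have "card e = 2" using e E by (auto simp: nsets_def)
        moreover from this obtain x y where "e = {x, y}" by (auto simp: card_2_iff)
        ultimately have "e = {i, \<pi> i}" using i by (auto simp: M_def)
        then show ?thesis using i by auto
      next
        case False
        then have "e' \<in> kept_edges \<pi> E" using e e' by (auto simp: kept_edges_def)
        then show ?thesis using e' by auto
      qed
    qed (use e in auto)
  qed
  moreover have fin_kept: "finite (kept_edges \<pi> E)" using finE by (simp add: kept_edges_def)
  ultimately have "card ?T \<le> card ((E - ?F) \<union> ?f ` kept_edges \<pi> E \<union> (\<lambda>i. {i, \<pi> i}) ` M)"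
    using finE finM by (intro card_mono) auto
  also have "\<dots> \<le> card (E - ?F) + card (?f ` kept_edges \<pi> E) + card ((\<lambda>i. {i, \<pi> i}) ` M)"
    by (intro order_trans[OF card_Un_le] add_mono card_Un_le order_refl)
  also have "\<dots> \<le> card (E - ?F) + card (kept_edges \<pi> E) + k"
    unfolding cM[symmetric] using finM fin_kept by (intro add_mono card_image_le order_refl)
  finally have T: "card ?T \<le> card (E - ?F) + card (kept_edges \<pi> E) + k" .
  have "k * d = (\<Sum>i\<in>M. d)" by (simp add: cM)
  also have "\<dots> \<le> (\<Sum>i\<in>M. degree E i)" by (intro sum_mono deg) (auto simp: M_def)
  also have "\<dots> \<le> 2 * card ?T"
    unfolding sum_degree_eq[OF E finM] by (rule sum_card_Int_le[OF E finE])
  finally have "k * d \<le> 2 * (card (E - ?F) + card (kept_edges \<pi> E) + k)"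
    using mult_le_mono2[OF T, of 2] by (rule order_trans)
  then have "real (k * d) \<le> real (2 * (card (E - ?F) + card (kept_edges \<pi> E) + k))"
    by (simp only: of_nat_le_iff)
  then show ?thesis unfolding dist by simp
qed

text \<open>The constants balance exactly: \<open>d >= 16\<close> gives
  \<open>2 * k <= k * d / 8\<close>, the kept edges cost another \<open>k * d / 8\<close>, and the
  remaining \<open>3/4 * k * d\<close> matches the edge bound at \<delta> = 1.\<close>

lemma asymmetric_graphI:
  assumes E: "E \<subseteq> nsets {1..n} 2" and deg: "\<And>i. i \<in> {1..n} \<Longrightarrow> d \<le> degree E i"
    and d: "16 \<le> d" and n: "n > 0" and delta: "0 < \<delta>" "\<delta> \<le> 1"
    and edges: "real (card E) \<le> 3 / 4 * real n * real d"
    and kept: "\<And>k \<pi>. k \<in> {1..n} \<Longrightarrow> k_permutation n k \<pi> \<Longrightarrow>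
      real (card (kept_edges \<pi> E)) \<le> real k * real d / 16"
  shows "asymmetric_graph n \<delta> E"
  unfolding asymmetric_graph_def
proof (intro conjI ballI allI impI delta(1))
  fix k \<pi> assume k: "k \<in> {1..n}" and pi: "k_permutation n k \<pi>"
  have "\<delta> * (real k / real n) * real (card E) \<le> 1 * (real k / real n) * (3 / 4 * real n * real d)"
    using delta edges by (intro mult_mono) auto
  also have "\<dots> = 3 / 4 * (real k * real d)" using n by simp
  also have "\<dots> \<le> real k * real d - 2 * real k - 2 * (real k * real d / 16)"
  proof -
    have "real k * 16 \<le> real k * real d" using d by (intro mult_left_mono) auto
    then show ?thesis by linarith
  qed
  also have "\<dots> \<le> graph_dist n E (permute_graph \<pi> E)"
    using graph_dist_permute_ge[OF E deg pi] kept[OF k pi] by linarith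
  finally show "\<delta> * (real k / real n) * real (card E) \<le> graph_dist n E (permute_graph \<pi> E)" .
qed

text \<open>A maximal \<open>F \<subseteq> P\<close> with \<open>f ` F \<inter> F = {}\<close> has the required size: by maximality every element of
  \<open>P\<close> lies in \<open>F\<close>, in its image or in its preimage.\<close>

lemma exists_third_disjoint_image:
  assumes P: "finite P" and inj: "inj f" and neq: "\<And>x. x \<in> P \<Longrightarrow> f x \<noteq> x" and t: "3 * t < card P + 3"
  shows "\<exists>F\<subseteq>P. card F = t \<and> f ` F \<inter> F = {}"
proof -
  define I where "I = {F. F \<subseteq> P \<and> f ` F \<inter> F = {}}"
  have "finite I" using P by (simp add: I_def)
  moreover have "{} \<in> I" by (simp add: I_def)
  ultimately have "\<exists>F\<in>I. {} \<subseteq> F \<and> (\<forall>G\<in>I. F \<subseteq> G \<longrightarrow> F = G)"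
    by (rule finite_has_maximal2)
  then obtain F where F: "F \<in> I" and max: "\<forall>G\<in>I. F \<subseteq> G \<longrightarrow> F = G"
    by blast
  have finF: "finite F" using F P finite_subset by (auto simp: I_def)
  have vim: "card (f -` F) \<le> card F"
    using card_vimage_inj_on_le[OF inj finF] by simp
  have "P \<subseteq> F \<union> f ` F \<union> (f -` F)"
  proof
    fix x assume x: "x \<in> P"
    show "x \<in> F \<union> f ` F \<union> (f -` F)"
    proof (rule ccontr)
      assume nx: "x \<notin> F \<union> f ` F \<union> (f -` F)"
      then have "insert x F \<in> I" using x F neq[OF x] by (auto simp: I_def)
      then have "F = insert x F" using max by (meson subset_insertI)
      then show False using nx by auto
    qed
  qed
  then have "card P \<le> card (F \<union> f ` F \<union> (f -` F))"
    using finF inj by (intro card_mono) (auto simp: finite_vimageI)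
  also have "\<dots> \<le> card F + card (f ` F) + card (f -` F)"
    by (intro order_trans[OF card_Un_le] add_mono card_Un_le order_refl)
  also have "\<dots> \<le> card F + card F + card F"
    using finF inj by (intro add_mono card_image_le vim order_refl) auto
  \<comment> \<open>The hypothesis says that \<open>t\<close> is at most \<open>card P / 3\<close>
    rounded up, and \<open>card P <= 3 * card F\<close>.\<close>
  finally have "t \<le> card F" using t by linarith
  then obtain G where "G \<subseteq> F" "card G = t" by (rule obtain_subset_with_card_n)
  moreover have "F \<subseteq> P" "f ` F \<inter> F = {}" using F by (auto simp: I_def)
  ultimately show ?thesis by (intro exI[of _ G]) auto
qed

text \<open>\<open>t ^ t / fact t\<close> is a single term of the series of
  \<open>exp t\<close>.\<close>

lemma power_le_exp_fact: "real t ^ t \<le> exp (real t) * fact t"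
proof -
  have "real t ^ t /\<^sub>R fact t \<le> exp (real t)"
    using sum_le_suminf[OF summable_exp_generic[of "real t"], of "{t}"]
    by (simp add: exp_def)
  then show ?thesis by (simp add: field_simps)
qed

text \<open>A moved edge has a moved endpoint; choose it and the other end.\<close>

lemma card_moved_edges_le:
  assumes "k_permutation n k \<pi>"
  shows "card {e \<in> nsets {1..n} 2. \<pi> ` e \<noteq> e} \<le> k * n"
proof -
  define M where "M = {i \<in> {1..n}. \<pi> i \<noteq> i}"
  have "{e \<in> nsets {1..n} 2. \<pi> ` e \<noteq> e} \<subseteq> (\<lambda>(i, j). {i, j}) ` (M \<times> {1..n})"
  proof
    fix e assume e: "e \<in> {e \<in> nsets {1..n} 2. \<pi> ` e \<noteq> e}"
    then have "e \<subseteq> {1..n}" "card e = 2" by (auto simp: nsets_def)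
    then obtain x y where xy: "e = {x, y}" "x \<in> {1..n}" "y \<in> {1..n}"
      unfolding card_2_iff by blast
    then have "\<pi> x \<noteq> x \<or> \<pi> y \<noteq> y" using e by auto
    then show "e \<in> (\<lambda>(i, j). {i, j}) ` (M \<times> {1..n})"
    proof
      assume "\<pi> x \<noteq> x"
      then show ?thesis using xy by (intro image_eqI[of _ _ "(x, y)"]) (auto simp: M_def)
    next
      assume "\<pi> y \<noteq> y"
      then show ?thesis using xy by (intro image_eqI[of _ _ "(y, x)"]) (auto simp: M_def)
    qed
  qed
  then have "card {e \<in> nsets {1..n} 2. \<pi> ` e \<noteq> e} \<le> card ((\<lambda>(i, j). {i, j}) ` (M \<times> {1..n}))"
    by (intro card_mono) (auto simp: M_def)
  also have "\<dots> \<le> card (M \<times> {1..n})"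
    by (rule card_image_le) (auto simp: M_def)
  finally show ?thesis using assms by (simp add: card_cartesian_product k_permutation_def M_def)
qed

text \<open>Union bound over the \<open>t\<close>-sets \<open>F\<close> of moved edges disjoint from
  their image. The gain is that \<open>F\<close> determines its image: \<open>t\<close> edges are
  chosen, but \<open>2 * t\<close> edges must be present.\<close>

lemma prob_many_kept_edges_le:
  fixes M :: "graph pmf"
  assumes q: "\<And>A. A \<subseteq> nsets {1..n} 2 \<Longrightarrow> measure_pmf.prob M {E. A \<subseteq> E} \<le> q ^ card A"
    and supp: "set_pmf M \<subseteq> Pow (nsets {1..n} 2)"
    and pi: "k_permutation n k \<pi>"
  shows "measure_pmf.prob M {E. 3 * t < card (kept_edges \<pi> E) + 3} \<le>
    real (k * n choose t) * (q\<^sup>2) ^ t"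
proof -
  define U where "U = {e \<in> nsets {1..n} 2. \<pi> ` e \<noteq> e}"
  define Fs where "Fs = {F. F \<subseteq> U \<and> card F = t \<and> (`) \<pi> ` F \<inter> F = {}}"
  have perm: "\<pi> permutes {1..n}" using pi by (simp add: k_permutation_def)
  have inj: "inj ((`) \<pi>)" by (rule inj_image_permutes[OF perm])
  have finU: "finite U" by (simp add: U_def finite_imp_finite_nsets)
  have finFs: "finite Fs" using finU by (simp add: Fs_def)
  have "measure_pmf.prob M {E. 3 * t < card (kept_edges \<pi> E) + 3} \<le>
    measure_pmf.prob M (\<Union>F\<in>Fs. {E. F \<union> (`) \<pi> ` F \<subseteq> E})"
  proof (rule measure_pmf.finite_measure_mono_AE)
    have "E \<in> (\<Union>F\<in>Fs. {E. F \<union> (`) \<pi> ` F \<subseteq> E})"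
      if E: "E \<subseteq> nsets {1..n} 2" and big: "3 * t < card (kept_edges \<pi> E) + 3" for E
    proof -
      have "finite (kept_edges \<pi> E)"
        by (rule finite_subset[OF _ finU]) (use E in \<open>auto simp: kept_edges_def U_def\<close>)
      from exists_third_disjoint_image[OF this inj _ big]
      obtain F where F: "F \<subseteq> kept_edges \<pi> E" "card F = t" "(`) \<pi> ` F \<inter> F = {}"
        by (auto simp: kept_edges_def)
      then have "F \<in> Fs" using E by (auto simp: Fs_def U_def kept_edges_def)
      moreover have "F \<union> (`) \<pi> ` F \<subseteq> E" using F by (auto simp: kept_edges_def)
      ultimately show ?thesis by blast
    qed
    then show "AE E in M. E \<in> {E. 3 * t < card (kept_edges \<pi> E) + 3} \<longrightarrow>
        E \<in> (\<Union>F\<in>Fs. {E. F \<union> (`) \<pi> ` F \<subseteq> E})"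
      using supp by (auto simp: AE_measure_pmf_iff)
  qed simp
  also have "\<dots> \<le> (\<Sum>F\<in>Fs. measure_pmf.prob M {E. F \<union> (`) \<pi> ` F \<subseteq> E})"
    by (rule measure_pmf.finite_measure_subadditive_finite) (use finFs in auto)
  also have "\<dots> \<le> (\<Sum>F\<in>Fs. (q\<^sup>2) ^ t)"
  proof (rule sum_mono)
    fix F assume F: "F \<in> Fs"
    have finF: "finite F" using F finU finite_subset by (auto simp: Fs_def)
    have "card ((`) \<pi> ` F) = t"
      using F inj by (subst card_image) (auto simp: Fs_def intro: inj_on_subset)
    then have "card (F \<union> (`) \<pi> ` F) = t + t"
      using F finF by (subst card_Un_disjoint) (auto simp: Fs_def)
    moreover have "F \<union> (`) \<pi> ` F \<subseteq> nsets {1..n} 2"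
      using F image_permutes_nsets[OF perm] by (auto simp: Fs_def U_def)
    ultimately show "measure_pmf.prob M {E. F \<union> (`) \<pi> ` F \<subseteq> E} \<le> (q\<^sup>2) ^ t"
      using q[of "F \<union> (`) \<pi> ` F"] by (simp add: power2_eq_square power_mult_distrib power_add)
  qed
  also have "\<dots> = real (card Fs) * (q\<^sup>2) ^ t" by simp
  also have "\<dots> \<le> real (k * n choose t) * (q\<^sup>2) ^ t"
  proof (intro mult_right_mono)
    have "card Fs \<le> card {F. F \<subseteq> U \<and> card F = t}"
      using finU by (intro card_mono) (auto simp: Fs_def)
    also have "\<dots> = card U choose t" by (rule n_subsets[OF finU])
    also have "\<dots> \<le> k * n choose t"
      by (rule binomial_right_mono) (use card_moved_edges_le[OF pi] in \<open>simp add: U_def\<close>)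
    finally show "real (card Fs) \<le> real (k * n choose t)" by simp
  qed simp
  finally show ?thesis .
qed

text \<open>The standard estimate of the binomial by \<open>(exp 1 * m / t) ^ t\<close>, with 3 in
  place of \<open>exp 1\<close>.\<close>

lemma binomial_power_le:
  assumes "t > 0" "0 \<le> x"
  shows "real (m choose t) * x ^ t \<le> (3 * real m * x / real t) ^ t"
proof -
  have "real (m choose t) * real t ^ t \<le> real (m choose t) * (exp (real t) * fact t)"
    by (intro mult_left_mono power_le_exp_fact) auto
  also have "\<dots> = exp (real t) * real ((m choose t) * fact t)" by simp
  also have "\<dots> \<le> 3 ^ t * real (m ^ t)"
  proof (intro mult_mono)
    show "exp (real t) \<le> 3 ^ t"
      using power_mono[OF exp_le, of t] by (simp flip: exp_of_nat_mult)
    show "real ((m choose t) * fact t) \<le> real (m ^ t)"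
      using binomial_fact_pow[of m t] by (simp only: of_nat_le_iff)
  qed auto
  finally have "real (m choose t) * x ^ t \<le> 3 ^ t * real m ^ t / real t ^ t * x ^ t"
    using assms by (intro mult_right_mono) (auto simp: field_simps)
  then show ?thesis by (simp add: power_mult_distrib power_divide mult_ac)
qed

text \<open>A permutation is determined by its pairs \<open>(i, \<pi> i)\<close> at the
  \<open>k\<close> moved points, a \<open>k\<close>-subset of a set of size
  \<open>n^2\<close>.\<close>

lemma card_k_permutations_le: "card {\<pi>. k_permutation n k \<pi>} \<le> (n\<^sup>2) ^ k"
proof -
  let ?g = "\<lambda>\<pi>. {(i, j) \<in> {1..n} \<times> {1..n}. j = \<pi> i \<and> \<pi> i \<noteq> i}"
  have "card {\<pi>. k_permutation n k \<pi>} \<le> card {B. B \<subseteq> {1..n} \<times> {1..n} \<and> card B = k}"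
  proof (rule card_inj_on_le[where f = ?g])
    show "inj_on ?g {\<pi>. k_permutation n k \<pi>}"
    proof (rule inj_onI)
      fix \<pi> \<sigma> assume *: "\<pi> \<in> {\<pi>. k_permutation n k \<pi>}" "\<sigma> \<in> {\<pi>. k_permutation n k \<pi>}" "?g \<pi> = ?g \<sigma>"
      show "\<pi> = \<sigma>"
      proof
        fix i
        have eq: "(i, j) \<in> ?g \<pi> \<longleftrightarrow> (i, j) \<in> ?g \<sigma>" for j using *(3) by simp
        have p: "\<pi> permutes {1..n}" "\<sigma> permutes {1..n}" using * by (auto simp: k_permutation_def)
        show "\<pi> i = \<sigma> i"
        proof (cases "i \<in> {1..n}")
          case True
          then have "\<pi> i \<in> {1..n}" "\<sigma> i \<in> {1..n}" using p permutes_in_image by metis+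
          then show ?thesis using eq[of "\<pi> i"] eq[of "\<sigma> i"] True by auto
        next
          case False
          then show ?thesis using p by (simp add: permutes_not_in)
        qed
      qed
    qed
    show "?g ` {\<pi>. k_permutation n k \<pi>} \<subseteq> {B. B \<subseteq> {1..n} \<times> {1..n} \<and> card B = k}"
    proof (clarify, intro conjI)
      fix \<pi> assume pi: "k_permutation n k \<pi>"
      then have "?g \<pi> = (\<lambda>i. (i, \<pi> i)) ` {i \<in> {1..n}. \<pi> i \<noteq> i}"
        using permutes_in_image[of \<pi> "{1..n}"] by (auto simp: k_permutation_def)
      then show "card (?g \<pi>) = k"
        using pi by (simp add: card_image inj_on_def k_permutation_def)
    qed auto
    show "finite {B. B \<subseteq> {1..n} \<times> {1..n} \<and> card B = k}" by simp
  qed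
  also have "\<dots> = n\<^sup>2 choose k"
    by (subst n_subsets) (auto simp: card_cartesian_product power2_eq_square)
  also have "\<dots> \<le> (n\<^sup>2) ^ k" by (cases "k \<le> n\<^sup>2") (auto intro: binomial_le_pow simp: binomial_eq_0)
  finally show ?thesis .
qed

section \<open>The union bound\<close>

lemma prob_gnpd_many_kept_edges_le:
  assumes p: "0 \<le> p" "p \<le> 1" "p * (real n - 1) \<le> real d"
    and d: "384 \<le> d" "5184 * real d \<le> sqrt (real n)"
    and k: "k \<in> {1..n}" and pi: "k_permutation n k \<pi>"
  shows "measure_pmf.prob (gnpd n p d)
      {E. real k * real d / 16 < real (card (kept_edges \<pi> E))} \<le> (1 / real n ^ 4) ^ k"
proof -
  define q where "q = p + 2 * (real d / real (n - d))"
  \<comment> \<open>A third of the threshold \<open>k * d / 16\<close>, rounded up; the rounding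
    adds less than 1, which the \<open>+ 3\<close> in \<open>prob_many_kept_edges_le\<close>
    absorbs.\<close>
  define t where "t = nat \<lceil>real k * real d / 48\<rceil>"
  have n: "n > 0" using k by simp
  have "sqrt (real n) \<le> real n" using n by (simp add: real_le_lsqrt power2_eq_square)
  then have dn: "2 * real d \<le> real n" "d < n" using d by linarith+
  have q0: "0 \<le> q" using p by (simp add: q_def)
  have q_le: "q \<le> 6 * real d / real n"
  proof -
    have "p * real n \<le> 2 * real d"
    proof -
      have "p * real n \<le> p * (2 * (real n - 1))"
        using p dn d by (intro mult_left_mono) auto
      then show ?thesis using p(3) by linarith
    qed
    then have "p \<le> 2 * (real d / real n)" using n by (simp add: field_simps)
    moreover have "2 * (real d / real (n - d)) \<le> 4 * (real d / real n)"
    proof -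
      have "real d / real (n - d) \<le> real d / (real n / 2)"
        using dn n by (intro divide_left_mono) auto
      then show ?thesis by simp
    qed
    ultimately have "q \<le> 2 * (real d / real n) + 4 * (real d / real n)"
      unfolding q_def by (rule add_mono)
    then show ?thesis by simp
  qed
  have t_ge: "real k * real d / 48 \<le> real t" by (simp add: t_def real_nat_ceiling_ge)
  have t_lt: "real t < real k * real d / 48 + 1"
  proof -
    have "real (nat \<lceil>x\<rceil>) < x + 1" if "0 \<le> x" for x :: real
      using that by linarith
    then show ?thesis by (simp add: t_def)
  qed
  have kd: "real k * 384 \<le> real k * real d" using d by (intro mult_left_mono) auto
  \<comment> \<open>\<open>384 = 8 * 48\<close>.\<close>
  have t8: "8 * k \<le> t"
  proof -
    have "real (8 * k) \<le> real t" using t_ge kd by simp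
    then show ?thesis by (simp only: of_nat_le_iff)
  qed
  then have t0: "t > 0" using k by auto
  have "measure_pmf.prob (gnpd n p d) {E. real k * real d / 16 < real (card (kept_edges \<pi> E))} \<le>
      measure_pmf.prob (gnpd n p d) {E. 3 * t < card (kept_edges \<pi> E) + 3}"
  proof (rule measure_pmf.finite_measure_mono)
    show "{E. real k * real d / 16 < real (card (kept_edges \<pi> E))} \<subseteq>
        {E. 3 * t < card (kept_edges \<pi> E) + 3}"
    proof clarify
      fix E assume "real k * real d / 16 < real (card (kept_edges \<pi> E))"
      then have "real (3 * t) < real (card (kept_edges \<pi> E) + 3)" using t_lt by simp
      then show "3 * t < card (kept_edges \<pi> E) + 3" by (simp only: of_nat_less_iff)
    qed
  qed simp
  also have "\<dots> \<le> real (k * n choose t) * (q\<^sup>2) ^ t"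
  proof (rule prob_many_kept_edges_le[OF _ _ pi])
    show "set_pmf (gnpd n p d) \<subseteq> Pow (nsets {1..n} 2)"
      using set_pmf_stage[OF dn(2) order_refl, of _ p] by (auto simp only: gnpd_eq_stage Pow_iff)
  qed (use prob_gnpd_superset_le[OF p(1,2) dn(2)] in \<open>simp only: q_def\<close>)
  also have "\<dots> \<le> (3 * real (k * n) * q\<^sup>2 / real t) ^ t"
    by (rule binomial_power_le) (use t0 in auto)
  also have "\<dots> \<le> (1 / sqrt (real n)) ^ t"
  proof (rule power_mono)
    have "3 * real (k * n) * q\<^sup>2 / real t \<le>
        3 * real (k * n) * (6 * real d / real n)\<^sup>2 / (real k * real d / 48)"
      using q0 q_le t_ge t0 k d by (intro frac_le mult_left_mono power_mono) auto
    \<comment> \<open>\<open>3 * 36 * 48 = 5184\<close>, which explains the constant in the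
      hypothesis on \<open>d\<close>.\<close>
    also have "\<dots> = 5184 * real d / real n"
      using k n d by (simp add: power2_eq_square field_simps)
    also have "\<dots> \<le> sqrt (real n) / real n"
      using d by (intro divide_right_mono) auto
    also have "\<dots> = 1 / sqrt (real n)"
      using n by (simp add: field_simps)
    finally show "3 * real (k * n) * q\<^sup>2 / real t \<le> 1 / sqrt (real n)" .
  qed simp
  \<comment> \<open>The base is at most 1, so the exponent may be lowered to \<open>8 * k\<close>;
    the square root then leaves \<open>n^(-4k)\<close>.\<close>
  also have "\<dots> \<le> (1 / sqrt (real n)) ^ (8 * k)"
    using n t8 by (intro power_decreasing) auto
  also have "\<dots> = (((1 / sqrt (real n)) ^ 2) ^ 4) ^ k"
    by (simp flip: power_mult)
  also have "\<dots> = (1 / real n ^ 4) ^ k"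
    by (simp add: power_divide)
  finally show ?thesis .
qed

text \<open>The two error terms come from too many edges (\<open>B\<close>) and from some
  permutation keeping too many edges (\<open>K\<close>); outside these events
  \<open>asymmetric_graphI\<close> applies.\<close>

lemma prob_gnpd_asymmetric_ge:
  assumes p: "0 \<le> p" "p \<le> 1" "real d - 1 \<le> p * (real n - 1)" "p * (real n - 1) \<le> real d"
    and d: "384 \<le> d" "5184 * real d \<le> sqrt (real n)"
    and delta: "0 < \<delta>" "\<delta> \<le> 1"
  shows "1 - exp (- real n) - 1 / real n \<le>
    measure_pmf.prob (gnpd n p d) {E. asymmetric_graph n \<delta> E}"
proof -
  let ?M = "gnpd n p d"
  define B :: "graph set" where "B = {E. 3 / 4 * real n * real d < real (card E)}"
  define K where "K k \<pi> = {E. real k * real d / 16 < real (card (kept_edges \<pi> E))}"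
    for k :: nat and \<pi> :: "nat \<Rightarrow> nat"
  define Pi where "Pi k = {\<pi>. k_permutation n k \<pi>}" for k
  have sqrt_pos: "0 < sqrt (real n)" using d by linarith
  then have n: "n > 0" by simp
  have "sqrt (real n) \<le> real n" using n by (simp add: real_le_lsqrt power2_eq_square)
  then have dn: "d < n" using d by linarith
  have finPi: "finite (Pi k)" for k
    by (rule finite_subset[OF _ finite_permutations[of "{1..n}"]])
      (auto simp: Pi_def k_permutation_def)
  have "measure_pmf.prob ?M (- {E. asymmetric_graph n \<delta> E}) \<le>
      measure_pmf.prob ?M (B \<union> (\<Union>k\<in>{1..n}. \<Union>\<pi>\<in>Pi k. K k \<pi>))"
  proof (rule measure_pmf.finite_measure_mono_AE)
    have "E \<in> B \<union> (\<Union>k\<in>{1..n}. \<Union>\<pi>\<in>Pi k. K k \<pi>)"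
      if "E \<in> set_pmf ?M" "\<not> asymmetric_graph n \<delta> E" for E
    proof (rule ccontr)
      assume none: "E \<notin> B \<union> (\<Union>k\<in>{1..n}. \<Union>\<pi>\<in>Pi k. K k \<pi>)"
      have supp: "E \<subseteq> nsets {1..n} 2 \<and> (\<forall>i\<in>{1..n}. d \<le> degree E i)"
        using that(1) unfolding gnpd_eq_stage by (rule set_pmf_stage[OF dn order_refl])
      have "asymmetric_graph n \<delta> E"
      proof (rule asymmetric_graphI[where d=d])
        show "real (card E) \<le> 3 / 4 * real n * real d" using none by (simp add: B_def)
        show "real (card (kept_edges \<pi> E)) \<le> real k * real d / 16"
          if "k \<in> {1..n}" "k_permutation n k \<pi>" for k \<pi>
          using none that unfolding K_def Pi_def by (force simp: not_less)
      qed (use supp d n delta in auto)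
      then show False using that(2) by simp
    qed
    then show "AE E in ?M. E \<in> - {E. asymmetric_graph n \<delta> E} \<longrightarrow>
        E \<in> B \<union> (\<Union>k\<in>{1..n}. \<Union>\<pi>\<in>Pi k. K k \<pi>)"
      unfolding AE_measure_pmf_iff by blast
  qed simp
  also have "\<dots> \<le> measure_pmf.prob ?M B + (\<Sum>k\<in>{1..n}. \<Sum>\<pi>\<in>Pi k. measure_pmf.prob ?M (K k \<pi>))"
    using finPi
    by (intro order_trans[OF measure_Un_le] add_left_mono
        order_trans[OF measure_pmf.finite_measure_subadditive_finite] sum_mono
        measure_pmf.finite_measure_subadditive_finite) auto
  also have "\<dots> \<le> exp (- real n) + 1 / real n"
  proof (rule add_mono)
    have "measure_pmf.prob ?M B \<le> exp (real n * (5 / 4 - real d / 32))"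
      unfolding B_def by (rule prob_gnpd_card_gt_le) (use p dn in auto)
    \<comment> \<open>\<open>384 / 32 = 12\<close> makes the factor at most -1.\<close>
    also have "\<dots> \<le> exp (real n * (- 1))"
      using d by (intro iffD2[OF exp_le_cancel_iff] mult_left_mono) auto
    finally show "measure_pmf.prob ?M B \<le> exp (- real n)" by simp
    have "(\<Sum>k\<in>{1..n}. \<Sum>\<pi>\<in>Pi k. measure_pmf.prob ?M (K k \<pi>)) \<le> (\<Sum>k\<in>{1..n}. 1 / real n ^ 2)"
    proof (rule sum_mono)
      fix k assume k: "k \<in> {1..n}"
      have "(\<Sum>\<pi>\<in>Pi k. measure_pmf.prob ?M (K k \<pi>)) \<le> (\<Sum>\<pi>\<in>Pi k. (1 / real n ^ 4) ^ k)"
        unfolding K_def Pi_def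
        by (intro sum_mono prob_gnpd_many_kept_edges_le) (use p d k in auto)
      also have "\<dots> = real (card (Pi k)) * (1 / real n ^ 4) ^ k" by simp
      also have "\<dots> \<le> real ((n\<^sup>2) ^ k) * (1 / real n ^ 4) ^ k"
        unfolding Pi_def using card_k_permutations_le[of n k]
        by (intro mult_right_mono) (simp_all only: of_nat_le_iff zero_le_power zero_le_divide_1_iff of_nat_0_le_iff)
      also have "\<dots> = (real n ^ 2 * (1 / real n ^ 4)) ^ k"
        by (simp only: power_mult_distrib of_nat_power)
      also have "real n ^ 2 * (1 / real n ^ 4) = 1 / real n ^ 2"
        using n by (simp add: field_simps power2_eq_square eval_nat_numeral)
      \<comment> \<open>For each \<open>k\<close> the total is at most \<open>n^(-2k)\<close>, hence
        at most \<open>n^(-2)\<close>; the \<open>n\<close> values of \<open>k\<close> then sum to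
        \<open>1 / n\<close>.\<close>
      also have "(1 / real n ^ 2) ^ k \<le> (1 / real n ^ 2) ^ 1"
        using k n by (intro power_decreasing) (auto simp: field_simps)
      finally show "(\<Sum>\<pi>\<in>Pi k. measure_pmf.prob ?M (K k \<pi>)) \<le> 1 / real n ^ 2" by simp
    qed
    also have "\<dots> = 1 / real n" using n by (simp add: power2_eq_square)
    finally show "(\<Sum>k\<in>{1..n}. \<Sum>\<pi>\<in>Pi k. measure_pmf.prob ?M (K k \<pi>)) \<le> 1 / real n" .
  qed
  finally show ?thesis
    using measure_pmf.prob_compl[of "{E. asymmetric_graph n \<delta> E}" ?M]
    by (simp add: Compl_eq_Diff_UNIV)
qed

theorem theorem3:
  "\<exists>C::real. C > 0 \<and> (\<exists>c0::real. \<forall>c\<ge>c0. \<forall>(p :: nat \<Rightarrow> real) (d :: nat \<Rightarrow> nat).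
     (\<forall>\<^sub>F n in sequentially. c / real n \<le> p n \<and> p n \<le> (ln (real n))\<^sup>2 / real n) \<longrightarrow>
     (\<forall>n. d n = nat \<lceil>p n * (real n - 1)\<rceil>) \<longrightarrow>
     (\<lambda>n. measure_pmf.prob (gnpd n (p n) (d n))
            {G. asymmetric_graph n (1 - C / sqrt (real (d n))) G}) \<longlonglongrightarrow> 1)"
proof (rule exI[of _ 1], intro conjI zero_less_one, rule exI[of _ 1000], intro allI impI)
  fix c :: real and p :: "nat \<Rightarrow> real" and d :: "nat \<Rightarrow> nat"
  assume c: "1000 \<le> c"
    and ev: "\<forall>\<^sub>F n in sequentially. c / real n \<le> p n \<and> p n \<le> (ln (real n))\<^sup>2 / real n"
    and d: "\<forall>n. d n = nat \<lceil>p n * (real n - 1)\<rceil>"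
  let ?P = "\<lambda>n. measure_pmf.prob (gnpd n (p n) (d n))
            {G. asymmetric_graph n (1 - 1 / sqrt (real (d n))) G}"
  \<comment> \<open>The \<open>+ 1\<close> pays for the ceiling in \<open>d n\<close>.\<close>
  have "\<forall>\<^sub>F n in sequentially. 5184 * ((ln (real n))\<^sup>2 + 1) \<le> sqrt (real n)"
    by real_asymp
  moreover have "\<forall>\<^sub>F n in sequentially. (ln (real n))\<^sup>2 \<le> real n"
    by real_asymp
  ultimately have "\<forall>\<^sub>F n in sequentially. 1 - exp (- real n) - 1 / real n \<le> ?P n"
    using ev eventually_ge_at_top[of 2]
  proof eventually_elim
    case (elim n)
    define x where "x = p n * (real n - 1)"
    have p0: "0 \<le> p n" using elim c by (smt (verit) divide_nonneg_nonneg of_nat_0_le_iff)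
    have "(ln (real n))\<^sup>2 / real n \<le> 1" using elim by simp
    then have p1: "p n \<le> 1" using elim by linarith
    have "1000 / real n \<le> p n" using elim c by (smt (verit) divide_right_mono of_nat_0_le_iff)
    \<comment> \<open>For \<open>n >= 2\<close>, \<open>n - 1 >= n / 2\<close>, so the threshold
      1000 for \<open>c\<close> gives \<open>x >= 500\<close>, comfortably above the required
      384.\<close>
    then have "1000 / real n * (real n / 2) \<le> x"
      unfolding x_def using elim p0 by (intro mult_mono) auto
    then have x500: "500 \<le> x" using elim by simp
    have "x \<le> p n * real n" unfolding x_def using p0 by (intro mult_left_mono) auto
    also have "\<dots> \<le> (ln (real n))\<^sup>2" using elim by (simp add: field_simps)
    finally have x_le: "x \<le> (ln (real n))\<^sup>2" .
    have dx: "x \<le> real (d n)" "real (d n) - 1 \<le> x"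
      using d[rule_format, of n] x500 unfolding x_def[symmetric] by linarith+
    then have d384: "384 \<le> d n" using x500 by linarith
    show ?case
    proof (rule prob_gnpd_asymmetric_ge)
      show "5184 * real (d n) \<le> sqrt (real n)" using dx(2) x_le elim(1) by argo
      \<comment> \<open>All \<delta> in (0,1] are admissible, so the witness \<open>C = 1\<close>
        only has to keep this value positive.\<close>
      show "0 < 1 - 1 / sqrt (real (d n))" using d384 by simp
    qed (use p0 p1 dx d384 in \<open>auto simp: x_def\<close>)
  qed
  then show "?P \<longlonglongrightarrow> 1"
  proof (rule tendsto_sandwich)
    show "\<forall>\<^sub>F n in sequentially. ?P n \<le> 1" by simp
    show "(\<lambda>n. 1 - exp (- real n) - 1 / real n) \<longlonglongrightarrow> 1" by real_asymp
  qed simp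
qed

end
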